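(* Assume that $u_0$ satisfies one of the following hypotheses: $(\mathbf{H_1})$ $u_0\in L^\infty(\Omega)$, $u_0\ge1$ a.e. in $\Omega$, $u_0\not\equiv1$; $(\mathbf{H_2})$ $u_0\in L^\infty(\Omega)$, $0\le u_0\le1$ a.e. in $\Omega$, $\int_\Omega g(u_0(x))\,dx\ne0$; $(\mathbf{H_3})$ $u_0\in L^\infty(\Omega)$, $u_0\le0$ a.e. in $\Omega$, $u_0\not\equiv0$. Then Problem $(P)$ possesses a global solution $u\in C^1([0,\infty);L^\infty(\Omega))$. Moreover: (i) If $(\mathbf{H_1})$ holds, then for all $t\ge0$, $1\le u(x,t)\le\operatorname{ess\,sup}_\Omega u_0$ for a.e. $x\in\Omega$. (ii) If $(\mathbf{H_2})$ holds, then for all $t\ge0$, $0\le u(x,t)\le1$ for a.e. $x\in\Omega$. (iii) If $(\mathbf{H_3})$ holds, then for all $t\ge0$, $\operatorname{ess\,inf}_\Omega u_0\le u(x,t)\le0$ for a.e. $x\in\Omega$.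
   Context: Standing assumptions: $\Omega\subset\mathbb{R}^N$ ($N\ge1$) is an open bounded set; $p\in C^1(\mathbb{R})$ is strictly increasing on $\mathbb{R}$; $g\in C^1(\mathbb{R})$ satisfies $g(0)=g(1)=0$, $g>0$ on $(0,1)$ and $g<0$ on $(-\infty,0)\cup(1,\infty)$. For $v\in L^\infty(\Omega)$ with $\int_\Omega g(v)\ne0$ put $F(v):=g(v)p(v)-g(v)\dfrac{\int_\Omega g(v)p(v)}{\int_\Omega g(v)}$. Problem $(P)$ is the initial value problem $u_t=F(u)$, $t\ge0$, $u(x,0)=u_0(x)$, $x\in\Omega$. For $0<T\le\infty$, a function $u\in C^1([0,T);L^\infty(\Omega))$ is a solution of $(P)$ on $[0,T)$ if $u(0)=u_0$, $\int_\Omega g(u(t))\ne0$ for all $t\in[0,T)$, and $\frac{du}{dt}=F(u)$ on the whole interval $[0,T)$; it is global if $T=\infty$. *)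

theory Defs
  imports "HOL-Analysis.Analysis" "HOL-Probability.Essential_Supremum"
begin

text \<open>
  Elements of \<open>L\<^sup>\<infinity>(\<Omega>)\<close> are represented by functions, and equality in \<open>L\<^sup>\<infinity>(\<Omega>)\<close> by almost
  everywhere equality with respect to Lebesgue measure on \<open>\<Omega>\<close>. Values off \<open>\<Omega>\<close> are irrelevant.
  The norm takes values in \<^typ>\<open>ennreal\<close>, so that it is \<open>\<infinity>\<close>, rather than some
  junk real, on functions that are not essentially bounded.
\<close>

definition Linf_norm :: "'a::euclidean_space set \<Rightarrow> ('a \<Rightarrow> real) \<Rightarrow> ennreal" where
  "Linf_norm \<Omega> f = esssup (lebesgue_on \<Omega>) (\<lambda>x. ennreal \<bar>f x\<bar>)"

definition Linf :: "'a::euclidean_space set \<Rightarrow> ('a \<Rightarrow> real) set" where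
  "Linf \<Omega> = {f \<in> borel_measurable (lebesgue_on \<Omega>). Linf_norm \<Omega> f < \<infinity>}"

definition essinf :: "'a measure \<Rightarrow> ('a \<Rightarrow> ereal) \<Rightarrow> ereal" where
  "essinf M f = - esssup M (\<lambda>x. - f x)"

text \<open>
  At an end point of \<open>I\<close> belonging to \<open>I\<close>, the derivative is one-sided.
\<close>

definition has_Linf_derivative ::
  "'a::euclidean_space set \<Rightarrow> real set \<Rightarrow> (real \<Rightarrow> 'a \<Rightarrow> real) \<Rightarrow> ('a \<Rightarrow> real) \<Rightarrow> real \<Rightarrow> bool" where
  "has_Linf_derivative \<Omega> I u d t \<longleftrightarrow>
     d \<in> Linf \<Omega> \<and>
     ((\<lambda>s. Linf_norm \<Omega> (\<lambda>x. (u s x - u t x) / (s - t) - d x)) \<longlongrightarrow> 0) (at t within I)"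

definition continuous_Linf_on ::
  "'a::euclidean_space set \<Rightarrow> real set \<Rightarrow> (real \<Rightarrow> 'a \<Rightarrow> real) \<Rightarrow> bool" where
  "continuous_Linf_on \<Omega> I u \<longleftrightarrow>
     (\<forall>t\<in>I. u t \<in> Linf \<Omega>) \<and>
     (\<forall>t\<in>I. ((\<lambda>s. Linf_norm \<Omega> (\<lambda>x. u s x - u t x)) \<longlongrightarrow> 0) (at t within I))"

definition C1_Linf_on ::
  "'a::euclidean_space set \<Rightarrow> real set \<Rightarrow> (real \<Rightarrow> 'a \<Rightarrow> real) \<Rightarrow> bool" where
  "C1_Linf_on \<Omega> I u \<longleftrightarrow>
     (\<forall>t\<in>I. u t \<in> Linf \<Omega>) \<and>
     (\<exists>u'. continuous_Linf_on \<Omega> I u' \<and> (\<forall>t\<in>I. has_Linf_derivative \<Omega> I u (u' t) t))"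

definition F_op ::
  "'a::euclidean_space set \<Rightarrow> (real \<Rightarrow> real) \<Rightarrow> (real \<Rightarrow> real) \<Rightarrow> ('a \<Rightarrow> real) \<Rightarrow> 'a \<Rightarrow> real" where
  "F_op \<Omega> p g v x =
     g (v x) * p (v x) -
     g (v x) * ((LINT y|lebesgue_on \<Omega>. g (v y) * p (v y)) / (LINT y|lebesgue_on \<Omega>. g (v y)))"

definition is_solution ::
  "'a::euclidean_space set \<Rightarrow> (real \<Rightarrow> real) \<Rightarrow> (real \<Rightarrow> real) \<Rightarrow> ('a \<Rightarrow> real) \<Rightarrow> ereal \<Rightarrow>
   (real \<Rightarrow> 'a \<Rightarrow> real) \<Rightarrow> bool" where
  "is_solution \<Omega> p g u0 T u \<longleftrightarrow>
     (let I = {t. 0 \<le> t \<and> ereal t < T} in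
        0 < T \<and>
        C1_Linf_on \<Omega> I u \<and>
        (AE x in lebesgue_on \<Omega>. u 0 x = u0 x) \<and>
        (\<forall>t\<in>I. (LINT x|lebesgue_on \<Omega>. g (u t x)) \<noteq> 0) \<and>
        (\<forall>t\<in>I. has_Linf_derivative \<Omega> I u (F_op \<Omega> p g (u t)) t))"

abbreviation is_global_solution ::
  "'a::euclidean_space set \<Rightarrow> (real \<Rightarrow> real) \<Rightarrow> (real \<Rightarrow> real) \<Rightarrow> ('a \<Rightarrow> real) \<Rightarrow>
   (real \<Rightarrow> 'a \<Rightarrow> real) \<Rightarrow> bool" where
  "is_global_solution \<Omega> p g u0 u \<equiv> is_solution \<Omega> p g u0 \<infinity> u"

definition H1 :: "'a::euclidean_space set \<Rightarrow> ('a \<Rightarrow> real) \<Rightarrow> bool" where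
  "H1 \<Omega> u0 \<longleftrightarrow> u0 \<in> Linf \<Omega> \<and> (AE x in lebesgue_on \<Omega>. 1 \<le> u0 x) \<and>
     \<not> (AE x in lebesgue_on \<Omega>. u0 x = 1)"

definition H2 :: "'a::euclidean_space set \<Rightarrow> (real \<Rightarrow> real) \<Rightarrow> ('a \<Rightarrow> real) \<Rightarrow> bool" where
  "H2 \<Omega> g u0 \<longleftrightarrow> u0 \<in> Linf \<Omega> \<and> (AE x in lebesgue_on \<Omega>. 0 \<le> u0 x \<and> u0 x \<le> 1) \<and>
     (LINT x|lebesgue_on \<Omega>. g (u0 x)) \<noteq> 0"

definition H3 :: "'a::euclidean_space set \<Rightarrow> ('a \<Rightarrow> real) \<Rightarrow> bool" where
  "H3 \<Omega> u0 \<longleftrightarrow> u0 \<in> Linf \<Omega> \<and> (AE x in lebesgue_on \<Omega>. u0 x \<le> 0) \<and>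
     \<not> (AE x in lebesgue_on \<Omega>. u0 x = 0)"

end

theory Submission imports Defs begin

text \<open>
  The equation couples the points of \<open>\<Omega>\<close> only through \<open>\<lambda>(t) = \<integral>g(u)p(u) / \<integral>g(u)\<close>, so that
  \<open>u(t, x) = Y(t, u\<^sub>0(x))\<close>, where \<open>Y\<close> solves an ordinary differential equation in the Banach space of
  bounded continuous functions of the initial value. The values of \<open>Y\<close> are clamped to an interval
  \<open>[a, b]\<close>, \<open>\<lambda>\<close> to \<open>[p(a), p(b)]\<close>, and the denominator is bounded away from \<open>0\<close> by
  \<open>\<delta>(t) = exp (- C t) \<bar>\<integral>g(u\<^sub>0)\<bar>\<close>; the result is globally Lipschitz, locally uniformly in \<open>t\<close>, and has
  a global solution. As \<open>g\<close> has constant sign on \<open>[a, b]\<close>, \<open>\<integral>g(u)p(u) / \<integral>g(u)\<close> is an average of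
  \<open>p(u)\<close> and lies in \<open>[p(a), p(b)]\<close>; with \<open>g(a) \<le> 0\<close> and \<open>g(b) \<le> 0\<close> this makes \<open>[a, b]\<close> invariant,
  and \<open>\<partial>\<^sub>t \<bar>g(Y)\<bar> \<ge> - C \<bar>g(Y)\<bar>\<close> shows that the truncations are inactive.
\<close>

section \<open>Ordinary differential equations on a half line\<close>

text \<open>This admits \<open>bcontfun\<close> itself as the state space in
  \<open>global_picard\<close>.\<close>

instance bcontfun :: (metric_space, banach) banach ..

lemma integral_has_vector_derivative_atLeast:
  fixes f :: "real \<Rightarrow> 'a::banach"
  assumes "continuous_on {a..} f" "a \<le> t"
  shows "((\<lambda>s. integral {a..s} f) has_vector_derivative f t) (at t within {a..})"
proof -
  have "((\<lambda>s. integral {a..s} f) has_vector_derivative f t) (at t within {a..t + 1})"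
    using assms by (intro integral_has_vector_derivative continuous_on_subset[OF assms(1)]) auto
  moreover have "at t within {a..t + 1} = at t within {a..}"
    by (rule at_within_nhd[of _ "{..<t + 1}"]) auto
  ultimately show ?thesis by simp
qed

text \<open>Banach's fixed point theorem in the space of curves weighted by \<open>exp (- K t)\<close>, where \<open>K\<close> is
  chosen so that the integral operator has contraction constant \<open>1 / 2\<close> on the whole half line.\<close>
lemma global_picard:
  fixes G :: "real \<Rightarrow> 'a::banach \<Rightarrow> 'a"
  assumes cont: "\<And>x. continuous_on {0..} (\<lambda>t. G t x)"
    and lip: "\<And>t x y. 0 \<le> t \<Longrightarrow> norm (G t x - G t y) \<le> L t * norm (x - y)"
    and L: "continuous_on {0..} L"
  obtains u where "u 0 = x0"
    "\<And>t. 0 \<le> t \<Longrightarrow> (u has_vector_derivative G t (u t)) (at t within {0..})"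
    "continuous_on {0..} (\<lambda>t. G t (u t))"
proof -
  \<comment> \<open>Continuity along a curve follows from continuity in time and the Lipschitz bound
    in space: the increment is split at \<open>G s (w t)\<close>.\<close>
  have contG: "continuous_on {0..} (\<lambda>t. G t (w t))" if w: "continuous_on {0..} w" for w
    unfolding continuous_on_def
  proof
    fix t :: real assume t: "t \<in> {0..}"
    have "((\<lambda>s. L s * norm (w s - w t) + norm (G s (w t) - G t (w t)))
        \<longlongrightarrow> L t * norm (w t - w t) + norm (G t (w t) - G t (w t))) (at t within {0..})"
      using t w L cont[of "w t"] by (intro tendsto_intros) (auto simp: continuous_on_def)
    then have lim: "((\<lambda>s. L s * norm (w s - w t) + norm (G s (w t) - G t (w t))) \<longlongrightarrow> 0) (at t within {0..})"
      by simp
    have "((\<lambda>s. G s (w s) - G t (w t)) \<longlongrightarrow> 0) (at t within {0..})"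
    proof (rule Lim_null_comparison[OF _ lim])
      show "\<forall>\<^sub>F s in at t within {0..}. norm (G s (w s) - G t (w t))
          \<le> L s * norm (w s - w t) + norm (G s (w t) - G t (w t))"
        unfolding eventually_at_topological
      proof (intro exI[of _ UNIV] conjI ballI impI)
        fix s :: real assume "s \<in> {0..}"
        then show "norm (G s (w s) - G t (w t))
          \<le> L s * norm (w s - w t) + norm (G s (w t) - G t (w t))"
          using lip[of s "w s" "w t"] norm_triangle_ineq[of "G s (w s) - G s (w t)" "G s (w t) - G t (w t)"]
          by simp
      qed auto
    qed
    then show "((\<lambda>t. G t (w t)) \<longlongrightarrow> G t (w t)) (at t within {0..})"
      by (rule LIM_zero_cancel)
  qed
  \<comment> \<open>\<open>m\<close> dominates \<open>L\<close>, for the contraction, and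
    \<open>norm (G t 0)\<close>, for boundedness of the image. The factor \<open>2\<close> in
    \<open>K\<close> makes \<open>m * exp K\<close> the derivative of \<open>exp K / 2\<close>,
    which is where the constant \<open>1 / 2\<close> arises.\<close>
  define m where "m = (\<lambda>t. \<bar>L t\<bar> + norm (G t 0))"
  define K where "K = (\<lambda>t. 2 * integral {0..t} m)"
  have m: "continuous_on {0..} m"
    unfolding m_def by (intro continuous_intros L cont)
  have m0: "0 \<le> m t" and Lm: "L t \<le> m t" for t
    unfolding m_def using norm_ge_zero[of "G t 0"] by linarith+
  have K': "(K has_vector_derivative 2 * m t) (at t within {0..})" if "0 \<le> t" for t
    unfolding K_def
    by (rule has_vector_derivative_mult_right[OF integral_has_vector_derivative_atLeast[OF m that]])
  have Kc: "continuous_on {0..} K"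
    using K' by (auto simp: continuous_on_eq_continuous_within intro: has_vector_derivative_continuous)
  have K0: "0 \<le> K t" if "0 \<le> t" for t
    unfolding K_def
    by (auto intro!: integral_nonneg integrable_continuous_real continuous_on_subset[OF m] simp: m0)
  have contE: "continuous_on {0..} (\<lambda>s. G s (exp (K s) *\<^sub>R apply_bcontfun w s))" for w :: "real \<Rightarrow>\<^sub>C 'a"
    by (intro contG continuous_intros Kc) auto
  have int_w: "integral {0..t} (\<lambda>s. m s * exp (K s)) = (exp (K t) - 1) / 2"
     "(\<lambda>s. m s * exp (K s)) integrable_on {0..t}" if "0 \<le> t" for t
  proof -
    have "((\<lambda>s. m s * exp (K s)) has_integral (exp (K t) / 2 - exp (K 0) / 2)) {0..t}"
    proof (rule fundamental_theorem_of_calculus[OF that])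
      fix x assume x: "x \<in> {0..t}"
      have "(K has_real_derivative 2 * m x) (at x within {0..t})"
        using has_vector_derivative_within_subset[OF K'[of x], of "{0..t}"] x
        by (auto simp: has_real_derivative_iff_has_vector_derivative)
      from DERIV_cdivide[OF DERIV_chain2[OF DERIV_exp this], of 2]
      show "((\<lambda>t. exp (K t) / 2) has_vector_derivative m x * exp (K x)) (at x within {0..t})"
        by (simp add: has_real_derivative_iff_has_vector_derivative mult.commute)
    qed
    moreover have "K 0 = 0" by (simp add: K_def)
    ultimately show "integral {0..t} (\<lambda>s. m s * exp (K s)) = (exp (K t) - 1) / 2"
     "(\<lambda>s. m s * exp (K s)) integrable_on {0..t}"
      by (auto simp: has_integral_iff diff_divide_distrib)
  qed
  have int_le: "norm (integral {0..t} f) \<le> c * ((exp (K t) - 1) / 2)"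
    if "0 \<le> t" "continuous_on {0..} f" "\<And>s. 0 \<le> s \<Longrightarrow> norm (f s) \<le> c * (m s * exp (K s))"
    for f :: "real \<Rightarrow> 'a" and c t
  proof -
    have "norm (integral {0..t} f) \<le> integral {0..t} (\<lambda>s. c * (m s * exp (K s)))"
      using that int_w(2)[OF that(1)]
      by (intro integral_norm_bound_integral integrable_on_mult_right
          integrable_continuous_real[OF continuous_on_subset[OF that(2)]]) auto
    then show ?thesis using int_w[OF that(1)] by simp
  qed
  have int_half: "exp (- K t) * (c * ((exp (K t) - 1) / 2)) \<le> c / 2" if "0 \<le> c" for c t
  proof -
    have "exp (- K t) * (c * ((exp (K t) - 1) / 2)) = c / 2 - exp (- K t) * c / 2"
      by (simp add: exp_minus field_simps)
    then show ?thesis using that by simp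
  qed
  \<comment> \<open>The unknown \<open>w\<close> is the sought curve multiplied by
    \<open>exp (- K t)\<close>, so that the weighted norm becomes the ordinary supremum norm; \<phi>
    is the Picard operator conjugated by this weight.\<close>
  define \<phi> where "\<phi> = (\<lambda>(w :: real \<Rightarrow>\<^sub>C 'a) t.
      exp (- K t) *\<^sub>R (x0 + integral {0..t} (\<lambda>s. G s (exp (K s) *\<^sub>R apply_bcontfun w s))))"
  \<comment> \<open>Elements of \<open>bcontfun\<close> are defined on the whole line;
    \<open>max 0 t\<close> continues the curve to negative times by its value at
    \<open>0\<close>.\<close>
  define \<Phi> where "\<Phi> = (\<lambda>w. Bcontfun (\<lambda>t. \<phi> w (max 0 t)))"
  have \<phi>_cont: "continuous_on {0..} (\<phi> w)" for w
    unfolding \<phi>_def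
    using integral_has_vector_derivative_atLeast[OF contE[of w]]
    by (intro continuous_intros Kc)
       (auto simp: continuous_on_eq_continuous_within intro: has_vector_derivative_continuous)
  have \<phi>_bound: "norm (\<phi> w t) \<le> norm x0 + (1 + norm w) / 2" if t: "0 \<le> t" for w t
  proof -
    have "norm (integral {0..t} (\<lambda>s. G s (exp (K s) *\<^sub>R apply_bcontfun w s)))
        \<le> (1 + norm w) * ((exp (K t) - 1) / 2)"
    proof (rule int_le[OF t contE])
      fix s :: real assume s: "0 \<le> s"
      have "norm (G s (exp (K s) *\<^sub>R w s)) \<le> norm (G s (exp (K s) *\<^sub>R w s) - G s 0) + norm (G s 0)"
        using norm_triangle_ineq[of "G s (exp (K s) *\<^sub>R w s) - G s 0" "G s 0"] by simp
      also have "\<dots> \<le> L s * (exp (K s) * norm (w s)) + norm (G s 0)"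
        using lip[OF s, of "exp (K s) *\<^sub>R w s" 0] by simp
      also have "\<dots> \<le> m s * (exp (K s) * norm w) + m s * exp (K s)"
      proof (intro add_mono mult_mono)
        show "norm (G s 0) \<le> m s * exp (K s)"
          using mult_mono[of "norm (G s 0)" "m s" 1 "exp (K s)"] K0[OF s] m0[of s]
          by (simp add: m_def)
      qed (auto simp: m0 Lm norm_bounded)
      finally show "norm (G s (exp (K s) *\<^sub>R w s)) \<le> (1 + norm w) * (m s * exp (K s))"
        by (simp add: algebra_simps)
    qed
    then have "exp (- K t) * norm (integral {0..t} (\<lambda>s. G s (exp (K s) *\<^sub>R apply_bcontfun w s))) \<le> (1 + norm w) / 2"
      by (intro order_trans[OF mult_left_mono int_half]) auto
    moreover have "exp (- K t) * norm x0 \<le> norm x0"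
      using K0[OF t] by (simp add: mult_left_le_one_le)
    moreover have "norm (\<phi> w t) \<le> exp (- K t) * (norm x0 + norm (integral {0..t} (\<lambda>s. G s (exp (K s) *\<^sub>R apply_bcontfun w s))))"
      unfolding \<phi>_def norm_scaleR by (intro mult_mono norm_triangle_ineq) auto
    ultimately show ?thesis
      unfolding distrib_left by linarith
  qed
  have app: "apply_bcontfun (\<Phi> w) t = \<phi> w (max 0 t)" for w t
  proof -
    have "(\<lambda>t. \<phi> w (max 0 t)) \<in> bcontfun"
      by (rule bcontfun_normI[where b = "norm x0 + (1 + norm w) / 2"])
        (auto intro!: \<phi>_bound continuous_on_compose2[OF \<phi>_cont] continuous_intros)
    then show ?thesis by (simp add: \<Phi>_def Bcontfun_inverse)
  qed
  have "dist (\<Phi> v) (\<Phi> w) \<le> 1 / 2 * dist v w" for v w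
  proof (rule dist_bound)
    fix r :: real
    define t where "t = max 0 r"
    have t: "0 \<le> t" by (simp add: t_def)
    let ?f = "\<lambda>w s. G s (exp (K s) *\<^sub>R apply_bcontfun w s)"
    have "norm (integral {0..t} (\<lambda>s. ?f v s - ?f w s)) \<le> norm (v - w) * ((exp (K t) - 1) / 2)"
    proof (rule int_le[OF t])
      show "continuous_on {0..} (\<lambda>s. ?f v s - ?f w s)"
        by (intro continuous_intros contE)
      fix s :: real assume s: "0 \<le> s"
      have "norm (?f v s - ?f w s) \<le> L s * norm (exp (K s) *\<^sub>R v s - exp (K s) *\<^sub>R w s)"
        by (rule lip[OF s])
      also have "\<dots> = L s * (exp (K s) * norm (v s - w s))"
        by (simp flip: scaleR_right_diff_distrib)
      also have "\<dots> \<le> m s * (exp (K s) * norm (v - w))"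
        using norm_bounded[of "v - w" s] by (intro mult_mono) (auto simp: m0 Lm)
      finally show "norm (?f v s - ?f w s) \<le> norm (v - w) * (m s * exp (K s))"
        by (simp add: algebra_simps)
    qed
    then have "exp (- K t) * norm (integral {0..t} (\<lambda>s. ?f v s - ?f w s)) \<le> norm (v - w) / 2"
      by (intro order_trans[OF mult_left_mono int_half]) auto
    moreover have "integral {0..t} (\<lambda>s. ?f v s - ?f w s) = integral {0..t} (?f v) - integral {0..t} (?f w)"
      by (intro integral_diff integrable_continuous_real continuous_on_subset[OF contE]) auto
    then have "\<phi> v t - \<phi> w t = exp (- K t) *\<^sub>R integral {0..t} (\<lambda>s. ?f v s - ?f w s)"
      by (simp add: \<phi>_def flip: scaleR_right_diff_distrib)
    ultimately show "dist (\<Phi> v r) (\<Phi> w r) \<le> 1 / 2 * dist v w"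
      by (simp add: app t_def dist_norm)
  qed
  then obtain w where w: "\<Phi> w = w"
    using banach_fix_type[of "1/2" \<Phi>] by auto
  \<comment> \<open>Undoing the weight turns the fixed point into a solution of the integral
    equation.\<close>
  define u where "u = (\<lambda>t. x0 + integral {0..t} (\<lambda>s. G s (exp (K s) *\<^sub>R apply_bcontfun w s)))"
  have u: "exp (K t) *\<^sub>R w t = u t" if "0 \<le> t" for t
    using app[of w t] that unfolding w by (simp add: \<phi>_def u_def exp_minus)
  have "continuous_on {0..} (\<lambda>t. G t (u t)) \<longleftrightarrow> continuous_on {0..} (\<lambda>s. G s (exp (K s) *\<^sub>R apply_bcontfun w s))"
    by (rule continuous_on_cong) (auto simp: u)
  moreover have "(u has_vector_derivative G t (u t)) (at t within {0..})" if "0 \<le> t" for t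
    using has_vector_derivative_add[OF has_vector_derivative_const
        integral_has_vector_derivative_atLeast[OF contE that], of x0 w] u[OF that]
    by (simp add: u_def)
  ultimately show thesis
    using that[of u] contE[of w] by (simp add: u_def)
qed

text \<open>Consider the last time up to \<open>t\<close> at which \<open>y\<close> is at most
  \<open>b\<close>. From then on \<open>y\<close> is above \<open>b\<close>, where it cannot
  increase, so it never gets there. Lower barriers follow by passing to \<open>- y\<close>.\<close>

lemma upper_barrier:
  fixes y y' :: "real \<Rightarrow> real"
  assumes deriv: "\<And>t. 0 \<le> t \<Longrightarrow> (y has_real_derivative y' t) (at t within {0..})"
    and init: "y 0 \<le> b"
    and down: "\<And>t. \<lbrakk>0 \<le> t; b < y t\<rbrakk> \<Longrightarrow> y' t \<le> 0"
    and t: "0 \<le> t"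
  shows "y t \<le> b"
proof (rule ccontr)
  assume above: "\<not> y t \<le> b"
  have cont: "continuous_on {0..} y"
    using deriv by (auto simp: continuous_on_eq_continuous_within intro: DERIV_continuous)
  define S where "S = {0..t} \<inter> y -` {..b}"
  have "closed S"
    unfolding S_def by (intro continuous_closed_preimage continuous_on_subset[OF cont]) auto
  moreover have ne: "S \<noteq> {}" and bdd: "bdd_above S"
    using t init by (auto simp: S_def intro!: bdd_aboveI[of _ t] exI[of _ 0])
  ultimately have "Sup S \<in> S"
    by (intro closed_contains_Sup)
  then have s: "0 \<le> Sup S" "Sup S \<le> t" "y (Sup S) \<le> b" by (auto simp: S_def)
  have "y t \<le> y (Sup S)"
  proof (rule DERIV_nonpos_imp_decreasing_open[OF s(2)])
    fix r assume r: "Sup S < r" "r < t"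
    then have "r \<notin> S" using bdd cSup_upper[of r S] by auto
    then have "b < y r" using r s by (auto simp: S_def)
    moreover have "at r within {0..} = at r"
      using r s by (intro at_within_interior) (auto simp: interior_real_atLeast)
    ultimately show "\<exists>y'. (y has_real_derivative y') (at r) \<and> y' \<le> 0"
      using deriv[of r] down[of r] r s by auto
  qed (use s in \<open>auto intro!: continuous_on_subset[OF cont]\<close>)
  with s above show False by simp
qed

section \<open>Lipschitz constants and bounds of C^1 functions on compact intervals\<close>

lemma C1_bounds_on_Icc:
  fixes f :: "real \<Rightarrow> real"
  assumes "f C1_differentiable_on UNIV"
  obtains f' B where "\<And>x. (f has_real_derivative f' x) (at x)"
    "\<And>x. x \<in> {a..b} \<Longrightarrow> \<bar>f' x\<bar> \<le> B" "B-lipschitz_on {a..b} f"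
proof -
  obtain D where D: "\<And>x. (f has_real_derivative D x) (at x)" "continuous_on UNIV D"
    using assms by (auto simp: C1_differentiable_on_def has_real_derivative_iff_has_vector_derivative)
  have "bounded (D ` {a..b})"
    by (intro compact_imp_bounded compact_continuous_image continuous_on_subset[OF D(2)]) auto
  then obtain B where B: "\<forall>x\<in>{a..b}. norm (D x) \<le> B" and "0 < B"
    unfolding bounded_pos by blast
  have "B-lipschitz_on {a..b} f"
  proof (rule lipschitz_onI)
    fix x y assume "x \<in> {a..b}" "y \<in> {a..b}"
    then show "dist (f x) (f y) \<le> B * dist x y"
      unfolding dist_norm
      by (intro field_differentiable_bound[of "{a..b}" f D])
        (use B D(1) in \<open>auto intro: has_field_derivative_at_within\<close>)
  qed (use \<open>0 < B\<close> in simp)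
  show thesis by (rule that[OF D(1)]) (use B \<open>B-lipschitz_on {a..b} f\<close> in auto)
qed

text \<open>Clamping is 1-Lipschitz and confines the argument to a compact interval.
  \<open>B\<close> is the sum of the Lipschitz constant there and of a bound for \<bar>f\<bar>, so
  that one constant serves both purposes.\<close>

lemma C1_clamp_bounds:
  fixes f :: "real \<Rightarrow> real"
  assumes f: "f C1_differentiable_on UNIV" and ab: "a \<le> b"
  obtains B where "0 \<le> B" "B-lipschitz_on UNIV (\<lambda>s. f (max a (min b s)))"
    "\<And>s. \<bar>f (max a (min b s))\<bar> \<le> B"
proof -
  obtain K where K: "K-lipschitz_on {a..b} f"
    using C1_bounds_on_Icc[OF f] by metis
  have K0: "0 \<le> K" by (rule lipschitz_on_nonneg[OF K])
  define B where "B = K + \<bar>f a\<bar> + K * (b - a)"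
  have "K \<le> B" "0 \<le> B" using K0 ab by (auto simp: B_def)
  have clamp: "max a (min b s) \<in> {a..b}" for s using ab by auto
  have "B-lipschitz_on UNIV (\<lambda>s. f (max a (min b s)))"
  proof (rule lipschitz_onI)
    fix x y :: real
    have "dist (f (max a (min b x))) (f (max a (min b y))) \<le> K * dist (max a (min b x)) (max a (min b y))"
      by (rule lipschitz_onD[OF K clamp clamp])
    also have "\<dots> \<le> B * dist x y"
      using \<open>K \<le> B\<close> \<open>0 \<le> B\<close> by (intro mult_mono) (auto simp: dist_real_def)
    finally show "dist (f (max a (min b x))) (f (max a (min b y))) \<le> B * dist x y" .
  qed fact
  moreover have "\<bar>f (max a (min b s))\<bar> \<le> B" for s
  proof -
    have "\<bar>f (max a (min b s)) - f a\<bar> \<le> K * \<bar>max a (min b s) - a\<bar>"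
      using lipschitz_onD[OF K clamp[of s], of a] ab by (simp add: dist_real_def)
    also have "\<dots> \<le> K * (b - a)" using K0 ab by (intro mult_left_mono) auto
    finally show ?thesis using K0 by (simp add: B_def)
  qed
  ultimately show thesis using that \<open>0 \<le> B\<close> by blast
qed

section \<open>The nonlocal equation in the space of bounded continuous functions\<close>

text \<open>The superposition operator of \<open>f\<close>. \<open>Bcontfun\<close> is meaningful
  only if the composite is bounded and continuous, hence the hypotheses of
  \<open>apply_bcomp\<close>.\<close>

definition bcomp :: "(real \<Rightarrow> real) \<Rightarrow> ('a::topological_space \<Rightarrow>\<^sub>C real) \<Rightarrow> 'a \<Rightarrow>\<^sub>C real" where
  "bcomp f Y = Bcontfun (\<lambda>s. f (Y s))"

lemma apply_bcomp:
  assumes "continuous_on UNIV f" "\<And>s. \<bar>f s\<bar> \<le> B"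
  shows "apply_bcontfun (bcomp f Y) s = f (Y s)"
proof -
  have "(\<lambda>s. f (Y s)) \<in> bcontfun"
    using assms by (intro bcontfun_normI[where b = B] continuous_on_compose2[OF assms(1)]) auto
  then show ?thesis by (simp add: bcomp_def Bcontfun_inverse)
qed

lemma norm_bcomp_diff_le:
  assumes "B-lipschitz_on UNIV f" "\<And>s. \<bar>f s\<bar> \<le> B"
  shows "norm (bcomp f Y - bcomp f Z) \<le> B * norm (Y - Z)"
proof (rule norm_bound)
  fix s
  have "\<bar>f (Y s) - f (Z s)\<bar> \<le> B * \<bar>Y s - Z s\<bar>"
    using lipschitz_onD[OF assms(1), of "Y s" "Z s"] by (simp add: dist_real_def)
  also have "\<dots> \<le> B * norm (Y - Z)"
    using norm_bounded[of "Y - Z" s] lipschitz_on_nonneg[OF assms(1)] by (intro mult_left_mono) auto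
  finally show "norm ((bcomp f Y - bcomp f Z) s) \<le> B * norm (Y - Z)"
    by (simp add: apply_bcomp[OF lipschitz_on_continuous_on[OF assms(1)] assms(2)])
qed

lemma bounded_linear_apply_bcontfun:
  "bounded_linear (\<lambda>f. apply_bcontfun (f :: 'a::topological_space \<Rightarrow>\<^sub>C 'b::real_normed_vector) x)"
  by (rule bounded_linear_intro[where K = 1]) (auto simp: norm_bounded)

lemma (in finite_measure) abs_integral_le:
  fixes f :: "'a \<Rightarrow> real"
  assumes "integrable M f" "\<And>x. \<bar>f x\<bar> \<le> k"
  shows "\<bar>\<integral>x. f x \<partial>M\<bar> \<le> k * measure M (space M)"
proof -
  have "\<bar>\<integral>x. f x \<partial>M\<bar> \<le> (\<integral>x. \<bar>f x\<bar> \<partial>M)" by simp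
  also have "\<dots> \<le> (\<integral>x. k \<partial>M)" using assms by (intro integral_mono) auto
  finally show ?thesis by (simp add: mult.commute)
qed

lemma clamp_diff_le: "\<bar>max a (min b x) - max a (min b y)\<bar> \<le> \<bar>x - y\<bar>" for a b x y :: real
  by auto

text \<open>Applied to \<open>J q Y / max d (J h Y)\<close>, this makes \<open>lam d\<close>
  Lipschitz. The constant depends on the floor \<open>d\<close> of the denominator, which is why
  \<open>global_picard\<close> allows a time-dependent \<open>L\<close>.\<close>

lemma abs_divide_diff_le:
  fixes n m :: real
  assumes "0 < d" "d \<le> m" "d \<le> m'" "\<bar>n - n'\<bar> \<le> e" "\<bar>m - m'\<bar> \<le> e" "\<bar>n'\<bar> \<le> k"
  shows "\<bar>n / m - n' / m'\<bar> \<le> (1 / d + k / d\<^sup>2) * e"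
proof -
  have "n / m - n' / m' = (n - n') / m + n' * (m' - m) / (m * m')"
    using assms by (simp add: field_simps)
  also have "\<bar>\<dots>\<bar> \<le> \<bar>n - n'\<bar> / m + \<bar>n'\<bar> * \<bar>m - m'\<bar> / (m * m')"
    using assms by (intro order_trans[OF abs_triangle_ineq] add_mono)
      (auto simp: abs_mult abs_minus_commute)
  also have "\<dots> \<le> e / d + k * e / (d * d)"
    using assms by (intro add_mono frac_le mult_mono) auto
  finally show ?thesis by (simp add: power2_eq_square algebra_simps)
qed

text \<open>\<open>v\<close> is the initial datum and \<sigma> the sign of \<open>g\<close> on
  \<open>[a, b]\<close>, which lets one argument treat all three hypotheses. The initial mass is
  stated for the clamped datum because \<open>v\<close> need lie in \<open>[a, b]\<close> only
  almost everywhere.\<close>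

locale nonlocal_ode = finite_measure M for M :: "'x measure" +
  fixes a b \<sigma> :: real and p g :: "real \<Rightarrow> real" and v :: "'x \<Rightarrow> real"
  assumes ab: "a \<le> b" and v_meas [measurable]: "v \<in> borel_measurable M"
    and p_C1: "p C1_differentiable_on UNIV" and p_mono: "mono p"
    and g_C1: "g C1_differentiable_on UNIV"
    and g_a: "g a \<le> 0" and g_b: "g b \<le> 0"
    and \<sigma>: "\<bar>\<sigma>\<bar> = 1"
    and \<sigma>_g: "\<And>s. s \<in> {a..b} \<Longrightarrow> 0 \<le> \<sigma> * g s"
    and mass: "0 < (\<integral>x. \<sigma> * g (max a (min b (v x))) \<partial>M)"
begin

abbreviation (input) clamp_ab :: "real \<Rightarrow> real" where "clamp_ab s \<equiv> max a (min b s)"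
definition h :: "real \<Rightarrow> real" where "h s = g (clamp_ab s)"
definition q :: "real \<Rightarrow> real" where "q s = g (clamp_ab s) * p (clamp_ab s)"
text \<open>The factor \<sigma> makes the integrand nonnegative for \<open>f = h\<close> and cancels
  in \<open>J q Y / J h Y\<close>.\<close>

definition J :: "(real \<Rightarrow> real) \<Rightarrow> (real \<Rightarrow>\<^sub>C real) \<Rightarrow> real" where
  "J f Y = (\<integral>x. \<sigma> * f (Y (v x)) \<partial>M)"
text \<open>Equals \<open>\<integral>g p / \<integral>g\<close> as soon as the range of \<open>Y\<close> lies in \<open>[a, b]\<close> and \<open>\<bar>\<integral>g\<bar> \<ge> d\<close>.\<close>
definition lam :: "real \<Rightarrow> (real \<Rightarrow>\<^sub>C real) \<Rightarrow> real" where
  "lam d Y = max (p a) (min (p b) (J q Y / max d (J h Y)))"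

lemma clamp_mem: "clamp_ab s \<in> {a..b}" using ab by auto

lemma clamp_clamp: "clamp_ab (clamp_ab s) = clamp_ab s" using ab by auto

lemma p_ab: "p a \<le> p b" using monoD[OF p_mono ab] .

lemma lam_bounds: "p a \<le> lam d Y" "lam d Y \<le> p b"
  using p_ab by (auto simp: lam_def)

lemma h_q_bounds:
  obtains B where "0 \<le> B" "B-lipschitz_on UNIV h" "\<And>s. \<bar>h s\<bar> \<le> B"
    "B-lipschitz_on UNIV q" "\<And>s. \<bar>q s\<bar> \<le> B"
proof -
  obtain B where B: "0 \<le> B" "B-lipschitz_on UNIV h" "\<And>s. \<bar>h s\<bar> \<le> B"
    using C1_clamp_bounds[OF g_C1 ab] unfolding h_def[abs_def] by metis
  obtain B' where B': "0 \<le> B'" "B'-lipschitz_on UNIV q" "\<And>s. \<bar>q s\<bar> \<le> B'"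
    using C1_clamp_bounds[OF C1_differentiable_on_mult[OF g_C1 p_C1] ab]
    unfolding q_def[abs_def] by metis
  show thesis
  proof
    show "(max B B')-lipschitz_on UNIV h" "(max B B')-lipschitz_on UNIV q"
      using B(2) B'(2) by (auto intro: lipschitz_on_le)
  qed (use B B' in \<open>auto simp: le_max_iff_disj\<close>)
qed

lemma integrable_comp:
  assumes "continuous_on UNIV f" "\<And>s. \<bar>f s\<bar> \<le> B"
  shows "integrable M (\<lambda>x. \<sigma> * f (apply_bcontfun Y (v x)))"
proof -
  have [measurable]: "f \<in> borel_measurable borel" "apply_bcontfun Y \<in> borel_measurable borel"
    using assms(1) by (auto intro: borel_measurable_continuous_onI)
  show ?thesis
    using assms(2) by (intro integrable_mult_right integrable_const_bound[where B = B]) auto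
qed

lemma J_diff_le:
  assumes "B-lipschitz_on UNIV f" "\<And>s. \<bar>f s\<bar> \<le> B"
  shows "\<bar>J f Y - J f Z\<bar> \<le> B * measure M (space M) * norm (Y - Z)"
proof -
  note int = integrable_comp[OF lipschitz_on_continuous_on[OF assms(1)] assms(2)]
  have "J f Y - J f Z = (\<integral>x. \<sigma> * f (Y (v x)) - \<sigma> * f (Z (v x)) \<partial>M)"
    unfolding J_def by (rule Bochner_Integration.integral_diff[symmetric]) (rule int)+
  also have "\<bar>\<dots>\<bar> \<le> B * norm (Y - Z) * measure M (space M)"
  proof (rule abs_integral_le)
    fix x
    have "\<bar>\<sigma> * f (Y (v x)) - \<sigma> * f (Z (v x))\<bar> = \<bar>f (Y (v x)) - f (Z (v x))\<bar>"
      using \<sigma> by (simp flip: right_diff_distrib add: abs_mult)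
    also have "\<dots> \<le> B * norm (Y - Z)"
      using norm_bounded[of "bcomp f Y - bcomp f Z" "v x"] norm_bcomp_diff_le[OF assms, of Y Z]
      by (simp add: apply_bcomp[OF lipschitz_on_continuous_on[OF assms(1)] assms(2)])
    finally show "\<bar>\<sigma> * f (Y (v x)) - \<sigma> * f (Z (v x))\<bar> \<le> B * norm (Y - Z)" .
  qed (intro Bochner_Integration.integrable_diff int)
  finally show ?thesis by (simp add: mult_ac)
qed

text \<open>\<open>h\<close> and \<open>q\<close> are bounded and Lipschitz; \<open>lam\<close> is
  bounded by its clamp and Lipschitz by the floor \<delta>. Hence the field is Lipschitz in the
  supremum norm with a constant continuous in time.\<close>

lemma exists_truncated_flow:
  assumes \<delta>_pos: "\<And>t::real. 0 < \<delta> t" and \<delta>_cont: "continuous_on {0..} \<delta>"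
  obtains Y where "\<And>s. apply_bcontfun (Y 0) s = clamp_ab s"
    "\<And>t. 0 \<le> t \<Longrightarrow>
      (Y has_vector_derivative bcomp q (Y t) - lam (\<delta> t) (Y t) *\<^sub>R bcomp h (Y t)) (at t within {0..})"
    "continuous_on {0..} (\<lambda>t. bcomp q (Y t) - lam (\<delta> t) (Y t) *\<^sub>R bcomp h (Y t))"
proof -
  obtain B where B: "0 \<le> B" "B-lipschitz_on UNIV h" "\<And>s. \<bar>h s\<bar> \<le> B"
    "B-lipschitz_on UNIV q" "\<And>s. \<bar>q s\<bar> \<le> B"
    by (rule h_q_bounds) auto
  define k where "k = B * measure M (space M)"
  define P where "P = \<bar>p a\<bar> + \<bar>p b\<bar>"
  \<comment> \<open>The three summands come from the variation of \<open>q\<close>, from that of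
    \<open>h\<close> multiplied by \<open>lam\<close>, and from that of \<open>lam\<close>
    multiplied by \<open>h\<close>.\<close>
  define L where "L = (\<lambda>t. B + (P * B + (1 / \<delta> t + k / (\<delta> t)\<^sup>2) * k * B))"
  \<comment> \<open>The natural initial value, the identity, is unbounded; clamping changes it only
    outside \<open>[a, b]\<close>.\<close>
  define y0 where "y0 = Bcontfun clamp_ab"
  have "clamp_ab \<in> bcontfun"
    by (rule bcontfun_normI[where b = "\<bar>a\<bar> + \<bar>b\<bar>"]) (auto intro!: continuous_intros)
  then have y0: "apply_bcontfun y0 s = clamp_ab s" for s
    by (simp add: y0_def Bcontfun_inverse)
  let ?G = "\<lambda>t Y. bcomp q Y - lam (\<delta> t) Y *\<^sub>R bcomp h Y"
  have lam_P: "\<bar>lam d Y\<bar> \<le> P" for d Y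
    using lam_bounds[of d Y] by (auto simp: P_def)
  have Jq: "\<bar>J q Y\<bar> \<le> k" for Y
    unfolding J_def k_def
    using \<sigma> B by (intro abs_integral_le integrable_comp[OF lipschitz_on_continuous_on[OF B(4)] B(5)])
      (auto simp: abs_mult)
  have lam_diff: "\<bar>lam (\<delta> t) Y - lam (\<delta> t) Z\<bar> \<le> (1 / \<delta> t + k / (\<delta> t)\<^sup>2) * (k * norm (Y - Z))" for t Y Z
  proof -
    have "\<bar>lam (\<delta> t) Y - lam (\<delta> t) Z\<bar>
        \<le> \<bar>J q Y / max (\<delta> t) (J h Y) - J q Z / max (\<delta> t) (J h Z)\<bar>"
      unfolding lam_def by (rule clamp_diff_le)
    also have "\<dots> \<le> (1 / \<delta> t + k / (\<delta> t)\<^sup>2) * (k * norm (Y - Z))"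
      using J_diff_le[OF B(2,3), of Y Z] J_diff_le[OF B(4,5), of Y Z] \<delta>_pos[of t] Jq[of Z]
      by (intro abs_divide_diff_le) (auto simp: k_def)
    finally show ?thesis .
  qed
  have h_norm: "norm (bcomp h Y) \<le> B" for Y :: "real \<Rightarrow>\<^sub>C real"
    by (rule norm_bound) (simp add: apply_bcomp[OF lipschitz_on_continuous_on[OF B(2)] B(3)] B(3))
  show thesis
  proof (rule global_picard[of ?G L y0])
    fix Y
    have "max (\<delta> t) (J h Y) \<noteq> 0" for t
      using \<delta>_pos[of t] by linarith
    then show "continuous_on {0..} (\<lambda>t. ?G t Y)"
      unfolding lam_def by (intro continuous_intros \<delta>_cont) auto
  next
    fix t :: real and Y Z assume "0 \<le> t"
    have "?G t Y - ?G t Z = (bcomp q Y - bcomp q Z)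
        - (lam (\<delta> t) Z *\<^sub>R (bcomp h Y - bcomp h Z) + (lam (\<delta> t) Y - lam (\<delta> t) Z) *\<^sub>R bcomp h Y)"
      by (simp add: algebra_simps)
    also have "norm \<dots> \<le> B * norm (Y - Z) + (P * (B * norm (Y - Z))
        + (1 / \<delta> t + k / (\<delta> t)\<^sup>2) * (k * norm (Y - Z)) * B)"
    proof (rule order_trans[OF norm_triangle_ineq4 add_mono[OF _ order_trans[OF norm_triangle_ineq add_mono]]])
      show "norm (bcomp q Y - bcomp q Z) \<le> B * norm (Y - Z)"
        by (rule norm_bcomp_diff_le[OF B(4,5)])
      show "norm (lam (\<delta> t) Z *\<^sub>R (bcomp h Y - bcomp h Z)) \<le> P * (B * norm (Y - Z))"
        unfolding norm_scaleR real_norm_def using lam_P[of "\<delta> t" Z]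
        by (intro mult_mono norm_bcomp_diff_le[OF B(2,3)]) (auto simp: P_def)
      show "norm ((lam (\<delta> t) Y - lam (\<delta> t) Z) *\<^sub>R bcomp h Y)
          \<le> (1 / \<delta> t + k / (\<delta> t)\<^sup>2) * (k * norm (Y - Z)) * B"
        unfolding norm_scaleR real_norm_def
        by (intro mult_mono lam_diff h_norm order_trans[OF abs_ge_zero lam_diff]) auto
    qed
    also have "\<dots> = L t * norm (Y - Z)"
      by (simp add: L_def algebra_simps)
    finally show "norm (?G t Y - ?G t Z) \<le> L t * norm (Y - Z)" .
  next
    show "continuous_on {0..} L"
      unfolding L_def using \<delta>_pos
      by (intro continuous_intros \<delta>_cont) (auto simp: less_imp_neq[symmetric])
  qed (use that y0 in auto)
qed

text \<open>Along the flow \<open>\<sigma> g\<close> decays at most exponentially at every point, hence so does \<open>\<bar>\<integral>g\<bar>\<close>: the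
  lower bound \<open>\<delta>\<close> imposed on the denominator is never active, and the truncated flow solves the
  original equation.\<close>
lemma exists_flow:
  obtains Y D where "\<And>s. apply_bcontfun (Y 0) s = clamp_ab s"
    "\<And>t. 0 \<le> t \<Longrightarrow> (Y has_vector_derivative D t) (at t within {0..})"
    "continuous_on {0..} D"
    "\<And>t s. 0 \<le> t \<Longrightarrow> Y t s \<in> {a..b}"
    "\<And>t. 0 \<le> t \<Longrightarrow> (\<integral>x. g (Y t (v x)) \<partial>M) \<noteq> 0"
    "\<And>t s. 0 \<le> t \<Longrightarrow> D t s = g (Y t s) * p (Y t s) -
      g (Y t s) * ((\<integral>x. g (Y t (v x)) * p (Y t (v x)) \<partial>M) / (\<integral>x. g (Y t (v x)) \<partial>M))"
proof -
  obtain g' A where g': "\<And>x. (g has_real_derivative g' x) (at x)"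
    and A: "\<And>x. x \<in> {a..b} \<Longrightarrow> \<bar>g' x\<bar> \<le> A"
    using C1_bounds_on_Icc[OF g_C1] by metis
  have A0: "0 \<le> A" using A[of a] ab by simp
  obtain B where B: "0 \<le> B" "B-lipschitz_on UNIV h" "\<And>s. \<bar>h s\<bar> \<le> B"
    "B-lipschitz_on UNIV q" "\<And>s. \<bar>q s\<bar> \<le> B"
    by (rule h_q_bounds) auto
  note h_int = integrable_comp[OF lipschitz_on_continuous_on[OF B(2)] B(3)]
  note q_int = integrable_comp[OF lipschitz_on_continuous_on[OF B(4)] B(5)]
  define C where "C = A * (p b - p a)"
  define I0 where "I0 = (\<integral>x. \<sigma> * g (clamp_ab (v x)) \<partial>M)"
  define \<delta> where "\<delta> = (\<lambda>t. exp (- C * t) * I0)"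
  have \<delta>_pos: "0 < \<delta> t" for t using mass by (simp add: \<delta>_def I0_def)
  have \<delta>_cont: "continuous_on {0..} \<delta>" unfolding \<delta>_def by (intro continuous_intros)
  obtain Y where Y0: "\<And>s. apply_bcontfun (Y 0) s = clamp_ab s"
    and Y': "\<And>t. 0 \<le> t \<Longrightarrow>
      (Y has_vector_derivative bcomp q (Y t) - lam (\<delta> t) (Y t) *\<^sub>R bcomp h (Y t)) (at t within {0..})"
    and cont: "continuous_on {0..} (\<lambda>t. bcomp q (Y t) - lam (\<delta> t) (Y t) *\<^sub>R bcomp h (Y t))"
    by (rule exists_truncated_flow[OF \<delta>_pos \<delta>_cont]) blast
  define D where "D = (\<lambda>t. bcomp q (Y t) - lam (\<delta> t) (Y t) *\<^sub>R bcomp h (Y t))"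
  define l where "l = (\<lambda>t. lam (\<delta> t) (Y t))"
  have D: "D t s = h (Y t s) * (p (clamp_ab (Y t s)) - l t)" for t s
    by (simp add: D_def l_def algebra_simps h_def q_def
        apply_bcomp[OF lipschitz_on_continuous_on[OF B(2)] B(3)]
        apply_bcomp[OF lipschitz_on_continuous_on[OF B(4)] B(5)])
  have y': "((\<lambda>t. Y t s) has_real_derivative D t s) (at t within {0..})" if "0 \<le> t" for t s
    using bounded_linear.has_vector_derivative[OF bounded_linear_apply_bcontfun Y'[OF that], of s]
    by (simp add: D_def has_real_derivative_iff_has_vector_derivative)
  have l: "p a \<le> l t" "l t \<le> p b" for t using lam_bounds by (auto simp: l_def)
  \<comment> \<open>Above \<open>b\<close> the clamped field equals
    \<open>g b * (p b - l t)\<close>, which is nonpositive whatever the value of \<open>l\<close> in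
    \<open>[p a, p b]\<close>. The lower bound is the mirror image.\<close>
  have le_b: "Y t s \<le> b" if t: "0 \<le> t" for t s
  proof (rule upper_barrier[OF y' _ _ t])
    show "Y 0 s \<le> b" using clamp_mem by (simp add: Y0)
    fix t assume "b < Y t s"
    then have "clamp_ab (Y t s) = b" using ab by auto
    then show "D t s \<le> 0" using l g_b by (simp add: D h_def mult_nonpos_nonneg)
  qed auto
  have ge_a: "a \<le> Y t s" if t: "0 \<le> t" for t s
  proof -
    have "- Y t s \<le> - a"
    proof (rule upper_barrier[OF DERIV_minus[OF y'] _ _ t])
      show "- Y 0 s \<le> - a" by (simp add: Y0)
      fix t assume "- a < - Y t s"
      then have "clamp_ab (Y t s) = a" using ab by auto
      then show "- D t s \<le> 0" using l g_a by (simp add: D h_def mult_nonpos_nonpos)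
    qed auto
    then show ?thesis by simp
  qed
  have mem: "Y t s \<in> {a..b}" and cl: "clamp_ab (Y t s) = Y t s" if "0 \<le> t" for t s
    using le_b[OF that, of s] ge_a[OF that, of s] by auto
  \<comment> \<open>Along the flow, \<open>\<sigma> * g (Y t s)\<close> satisfies a linear equation
    with coefficient \<open>g'(Y) (p(Y) - l) \<ge> - C\<close>; after multiplication by
    \<open>exp (C * t)\<close> it is nondecreasing.\<close>
  have decay: "exp (- C * t) * (\<sigma> * g (clamp_ab s)) \<le> \<sigma> * g (Y t s)" if t: "0 \<le> t" for t s
  proof -
    let ?z = "\<lambda>t. exp (C * t) * (\<sigma> * g (Y t s))"
    have z': "(?z has_real_derivative
        exp (C * t) * (\<sigma> * (g' (Y t s) * D t s)) + exp (C * t) * C * (\<sigma> * g (Y t s))) (at t within {0..})"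
      if "0 \<le> t" for t
      by (rule derivative_eq_intros y'[OF that] DERIV_chain2[OF g'] refl | simp)+
    have "?z 0 \<le> ?z t"
    proof (rule DERIV_nonneg_imp_increasing_open[OF t])
      show "continuous_on {0..t} ?z"
        by (rule continuous_on_subset[of "{0..}"])
          (use z' in \<open>auto simp: continuous_on_eq_continuous_within intro!: DERIV_continuous\<close>)
      fix r assume r: "0 < r" "r < t"
      have "\<bar>g' (Y r s) * (p (Y r s) - l r)\<bar> \<le> A * (p b - p a)"
        unfolding abs_mult
        using r A[OF mem] A0 l[of r] monoD[OF p_mono le_b[of r s]] monoD[OF p_mono ge_a[of r s]]
        by (intro mult_mono) auto
      then have "0 \<le> exp (C * r) * ((\<sigma> * g (Y r s)) * (C + g' (Y r s) * (p (Y r s) - l r)))"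
        using \<sigma>_g[OF mem, of r s] r
        by (intro mult_nonneg_nonneg[OF exp_ge_zero] mult_nonneg_nonneg[of "\<sigma> * g (Y r s)"])
          (auto simp: C_def)
      also have "\<dots> = exp (C * r) * (\<sigma> * (g' (Y r s) * D r s)) + exp (C * r) * C * (\<sigma> * g (Y r s))"
        using r by (simp add: D h_def cl algebra_simps)
      finally show "\<exists>y. (?z has_real_derivative y) (at r) \<and> 0 \<le> y"
        using z'[of r] r at_within_interior[of r "{0::real..}"] by auto
    qed
    then show ?thesis by (simp add: Y0 exp_minus field_simps)
  qed
  have Jh: "J h (Y t) = \<sigma> * (\<integral>x. g (Y t (v x)) \<partial>M)"
    and Jq: "J q (Y t) = \<sigma> * (\<integral>x. g (Y t (v x)) * p (Y t (v x)) \<partial>M)" if "0 \<le> t" for t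
    using that by (simp_all add: J_def h_def q_def cl)
  have \<delta>_le: "\<delta> t \<le> J h (Y t)" if t: "0 \<le> t" for t
  proof -
    have "\<delta> t = (\<integral>x. exp (- C * t) * (\<sigma> * h (Y 0 (v x))) \<partial>M)"
      by (simp add: \<delta>_def I0_def h_def Y0 clamp_clamp)
    also have "\<dots> \<le> J h (Y t)"
      unfolding J_def
      by (intro integral_mono[OF integrable_mult_right[OF h_int] h_int])
        (use decay[OF t] in \<open>simp add: h_def cl t Y0 clamp_clamp\<close>)
    finally show ?thesis .
  qed
  \<comment> \<open>The quotient is an average of \<open>p\<close> with nonnegative weight
    \<open>\<sigma> * h\<close> of positive total mass, so the clamp in \<open>lam\<close> is
    inactive; the floor is inactive by \<open>\<delta>_le\<close>.\<close>
  have l_eq: "l t = (\<integral>x. g (Y t (v x)) * p (Y t (v x)) \<partial>M) / (\<integral>x. g (Y t (v x)) \<partial>M)" if t: "0 \<le> t" for t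
  proof -
    have pos: "0 < J h (Y t)" using \<delta>_pos[of t] \<delta>_le[OF t] by simp
    have wt: "0 \<le> \<sigma> * h s" for s using \<sigma>_g[OF clamp_mem] by (simp add: h_def)
    have "J q (Y t) \<le> p b * J h (Y t)"
      unfolding J_def integral_mult_right_zero[symmetric]
    proof (intro integral_mono[OF q_int integrable_mult_right[OF h_int]])
      fix x
      show "\<sigma> * q (Y t (v x)) \<le> p b * (\<sigma> * h (Y t (v x)))"
        using mult_left_mono[OF monoD[OF p_mono, of "clamp_ab (Y t (v x))" b] wt] clamp_mem
        by (simp add: q_def h_def mult_ac)
    qed
    moreover have "p a * J h (Y t) \<le> J q (Y t)"
      unfolding J_def integral_mult_right_zero[symmetric]
    proof (intro integral_mono[OF integrable_mult_right[OF h_int] q_int])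
      fix x
      show "p a * (\<sigma> * h (Y t (v x))) \<le> \<sigma> * q (Y t (v x))"
        using mult_left_mono[OF monoD[OF p_mono, of a "clamp_ab (Y t (v x))"] wt] clamp_mem
        by (simp add: q_def h_def mult_ac)
    qed
    ultimately have "p a \<le> J q (Y t) / J h (Y t)" "J q (Y t) / J h (Y t) \<le> p b"
      using pos by (simp_all add: field_simps)
    then have "l t = J q (Y t) / J h (Y t)"
      using \<delta>_le[OF t] by (simp add: l_def lam_def max_absorb2 min_absorb2)
    then show ?thesis using \<sigma> by (auto simp: Jh[OF t] Jq[OF t])
  qed
  show thesis
  proof (rule that[of Y D])
    fix t :: real assume t: "0 \<le> t"
    show "(\<integral>x. g (Y t (v x)) \<partial>M) \<noteq> 0"
      using \<delta>_pos[of t] \<delta>_le[OF t] by (auto simp: Jh[OF t])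
    show "D t s = g (Y t s) * p (Y t s) -
      g (Y t s) * ((\<integral>x. g (Y t (v x)) * p (Y t (v x)) \<partial>M) / (\<integral>x. g (Y t (v x)) \<partial>M))" for s
      unfolding l_eq[OF t, symmetric] using t by (simp add: D h_def cl algebra_simps)
  qed (use Y0 Y' cont mem in \<open>auto simp: D_def\<close>)
qed

end

section \<open>From bounded continuous functions to essentially bounded ones\<close>

lemma Linf_norm_le:
  assumes "f \<in> borel_measurable (lebesgue_on \<Omega>)" "\<And>x. \<bar>f x\<bar> \<le> B"
  shows "Linf_norm \<Omega> f \<le> ennreal B"
  unfolding Linf_norm_def using assms by (intro esssup_I) (auto intro!: ennreal_leI)

lemma Linf_AE_bounded:
  assumes "f \<in> Linf \<Omega>"
  obtains B where "AE x in lebesgue_on \<Omega>. \<bar>f x\<bar> \<le> B"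
proof -
  obtain B where "0 \<le> B" "Linf_norm \<Omega> f = ennreal B"
    using assms by (cases "Linf_norm \<Omega> f") (auto simp: Linf_def)
  then have "AE x in lebesgue_on \<Omega>. \<bar>f x\<bar> \<le> B"
    using esssup_AE[of "\<lambda>x. ennreal \<bar>f x\<bar>" "lebesgue_on \<Omega>"]
    by (simp add: Linf_norm_def ennreal_le_iff)
  with that show thesis .
qed

text \<open>Were the essential supremum below \<open>c\<close>, the two bounds on \<open>f\<close>
  would be incompatible almost everywhere. The domain would be null and \<open>f = c\<close> almost
  everywhere would hold vacuously, against \<open>ne\<close>.\<close>

lemma Linf_esssup_real:
  assumes f: "f \<in> Linf \<Omega>" and ge: "AE x in lebesgue_on \<Omega>. c \<le> f x"
    and ne: "\<not> (AE x in lebesgue_on \<Omega>. f x = c)"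
  obtains b where "esssup (lebesgue_on \<Omega>) (\<lambda>x. ereal (f x)) = ereal b" "c \<le> b"
    "AE x in lebesgue_on \<Omega>. f x \<in> {c..b}"
proof -
  let ?M = "lebesgue_on \<Omega>" and ?s = "esssup (lebesgue_on \<Omega>) (\<lambda>x. ereal (f x))"
  have le: "AE x in ?M. ereal (f x) \<le> ?s" by (rule esssup_AE)
  obtain B where "AE x in ?M. \<bar>f x\<bar> \<le> B" using Linf_AE_bounded[OF f] .
  then have "?s \<le> ereal B"
    using f by (intro esssup_I) (auto elim!: eventually_mono simp: Linf_def)
  moreover have "ereal c \<le> ?s"
  proof (rule ccontr)
    assume less: "\<not> ereal c \<le> ?s"
    from le ge have "AE x in ?M. f x = c"
    proof eventually_elim
      case (elim x)
      then have "ereal c \<le> ?s" by (meson ereal_less_eq(3) order_trans)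
      with less show ?case by simp
    qed
    with ne show False by simp
  qed
  ultimately obtain b where b: "?s = ereal b" "c \<le> b" by (cases ?s) auto
  moreover have "AE x in ?M. f x \<in> {c..b}"
    using le ge unfolding b by eventually_elim auto
  ultimately show thesis by (rule that)
qed

section \<open>Composition with the initial datum\<close>

lemma measurable_bcontfun_comp [measurable]:
  assumes "v \<in> borel_measurable M"
  shows "(\<lambda>x. apply_bcontfun (Y :: 'b::topological_space \<Rightarrow>\<^sub>C real) (v x)) \<in> borel_measurable M"
proof -
  have [measurable]: "apply_bcontfun Y \<in> borel_measurable borel"
    by (auto intro: borel_measurable_continuous_onI)
  show ?thesis using assms by measurable
qed

text \<open>Composition with \<open>v\<close> does not increase norms, so limits, derivatives and
  continuity of curves pass from the supremum norm to \<open>Linf\<close>.\<close>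

lemma Linf_norm_bcontfun_comp_le:
  assumes "v \<in> borel_measurable (lebesgue_on \<Omega>)"
  shows "Linf_norm \<Omega> (\<lambda>x. apply_bcontfun Y (v x)) \<le> ennreal (norm Y)"
  using norm_bounded[of Y] assms by (intro Linf_norm_le) (auto intro: measurable_bcontfun_comp)

lemma bcontfun_comp_in_Linf:
  assumes "v \<in> borel_measurable (lebesgue_on \<Omega>)"
  shows "(\<lambda>x. apply_bcontfun Y (v x)) \<in> Linf \<Omega>"
  using assms Linf_norm_bcontfun_comp_le[OF assms, of Y]
  by (auto simp: Linf_def intro: measurable_bcontfun_comp order_le_less_trans)

lemma tendsto_Linf_norm_bcontfun_comp:
  assumes v: "v \<in> borel_measurable (lebesgue_on \<Omega>)" and Y: "(Y \<longlongrightarrow> 0) F"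
  shows "((\<lambda>s. Linf_norm \<Omega> (\<lambda>x. apply_bcontfun (Y s) (v x))) \<longlongrightarrow> 0) F"
proof (rule tendsto_sandwich[where f = "\<lambda>_. 0"])
  show "((\<lambda>s. ennreal (norm (Y s))) \<longlongrightarrow> 0) F"
    using tendsto_ennrealI[OF tendsto_norm[OF Y]] by simp
qed (use Linf_norm_bcontfun_comp_le[OF v] in auto)

lemma has_Linf_derivative_bcontfun_comp:
  assumes v: "v \<in> borel_measurable (lebesgue_on \<Omega>)"
    and Y: "(Y has_vector_derivative D) (at t within I)"
  shows "has_Linf_derivative \<Omega> I (\<lambda>t x. apply_bcontfun (Y t) (v x)) (\<lambda>x. D (v x)) t"
proof -
  have "((\<lambda>s. inverse (s - t) *\<^sub>R (Y s - Y t) - D) \<longlongrightarrow> 0) (at t within I)"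
  proof (rule Lim_null_comparison)
    show "((\<lambda>s. norm (Y s - Y t - (s - t) *\<^sub>R D) / norm (s - t)) \<longlongrightarrow> 0) (at t within I)"
      using Y by (simp add: has_vector_derivative_def has_derivative_iff_norm)
    have "norm (inverse (s - t) *\<^sub>R (Y s - Y t) - D) = norm (Y s - Y t - (s - t) *\<^sub>R D) / norm (s - t)"
      if "s \<noteq> t" for s
    proof -
      have "inverse (s - t) *\<^sub>R (Y s - Y t) - D = inverse (s - t) *\<^sub>R (Y s - Y t - (s - t) *\<^sub>R D)"
        using that by (simp add: scaleR_right_diff_distrib)
      then show ?thesis by (simp only: norm_scaleR) (simp add: divide_inverse mult.commute)
    qed
    then show "\<forall>\<^sub>F s in at t within I. norm (inverse (s - t) *\<^sub>R (Y s - Y t) - D)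
        \<le> norm (Y s - Y t - (s - t) *\<^sub>R D) / norm (s - t)"
      using eventually_neq_at_within[of t t I] by (auto elim!: eventually_mono)
  qed
  from tendsto_Linf_norm_bcontfun_comp[OF v this] show ?thesis
    unfolding has_Linf_derivative_def
    by (simp add: bcontfun_comp_in_Linf[OF v] divide_inverse mult.commute)
qed

lemma continuous_Linf_on_bcontfun_comp:
  assumes v: "v \<in> borel_measurable (lebesgue_on \<Omega>)" and Y: "continuous_on I Y"
  shows "continuous_Linf_on \<Omega> I (\<lambda>t x. apply_bcontfun (Y t) (v x))"
  unfolding continuous_Linf_on_def
proof (intro conjI ballI)
  fix t assume "t \<in> I"
  then have "((\<lambda>s. Y s - Y t) \<longlongrightarrow> 0) (at t within I)"
    using Y by (intro LIM_zero) (auto simp: continuous_on_def)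
  from tendsto_Linf_norm_bcontfun_comp[OF v this]
  show "((\<lambda>s. Linf_norm \<Omega> (\<lambda>x. apply_bcontfun (Y s) (v x) - apply_bcontfun (Y t) (v x))) \<longlongrightarrow> 0) (at t within I)"
    by simp
qed (rule bcontfun_comp_in_Linf[OF v])

text \<open>The solution is \<open>Y t (u0 x)\<close>. Its bounds hold at every point because those
  of \<open>Y\<close> do; only the initial condition is restricted to almost every point, namely
  where clamping fixes \<open>u0 x\<close>.\<close>

lemma exists_global_solution_between:
  fixes \<Omega> :: "'a::euclidean_space set"
  assumes "\<Omega> \<in> lmeasurable"
    and p: "p C1_differentiable_on UNIV" "mono p"
    and g: "g C1_differentiable_on UNIV" "g a \<le> 0" "g b \<le> 0"
    and sign: "\<bar>\<sigma>\<bar> = 1" "\<And>s. s \<in> {a..b} \<Longrightarrow> 0 \<le> \<sigma> * g s"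
    and "a \<le> b"
    and u0: "u0 \<in> borel_measurable (lebesgue_on \<Omega>)"
    and range: "AE x in lebesgue_on \<Omega>. u0 x \<in> {a..b}"
    and mass: "(LINT x|lebesgue_on \<Omega>. g (u0 x)) \<noteq> 0"
  obtains u where "is_global_solution \<Omega> p g u0 u" "\<And>t x. 0 \<le> t \<Longrightarrow> u t x \<in> {a..b}"
proof -
  interpret finite_measure "lebesgue_on \<Omega>"
    by (rule finite_measure_lebesgue_on) fact
  have g_cont: "continuous_on UNIV g"
    by (rule differentiable_imp_continuous_on[OF C1_diff_imp_diff[OF g(1)]])
  have [measurable]: "g \<in> borel_measurable borel"
    using g_cont by (rule borel_measurable_continuous_onI)
  note u0 [measurable]
  have "(\<integral>x. \<sigma> * g (max a (min b (u0 x))) \<partial>lebesgue_on \<Omega>) = (\<integral>x. \<sigma> * g (u0 x) \<partial>lebesgue_on \<Omega>)"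
  proof (rule integral_cong_AE)
    show "AE x in lebesgue_on \<Omega>. \<sigma> * g (max a (min b (u0 x))) = \<sigma> * g (u0 x)"
      using range by eventually_elim auto
  qed measurable
  moreover have "0 \<le> (\<integral>x. \<sigma> * g (u0 x) \<partial>lebesgue_on \<Omega>)"
    using range sign(2) by (intro integral_nonneg_AE) auto
  moreover have "(\<integral>x. \<sigma> * g (u0 x) \<partial>lebesgue_on \<Omega>) \<noteq> 0"
    using mass sign(1) by auto
  ultimately have "0 < (\<integral>x. \<sigma> * g (max a (min b (u0 x))) \<partial>lebesgue_on \<Omega>)" by linarith
  then interpret nonlocal_ode "lebesgue_on \<Omega>" a b \<sigma> p g u0
    using assms by unfold_locales auto
  obtain Y D where Y: "\<And>s. apply_bcontfun (Y 0) s = max a (min b s)"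
    "\<And>t. 0 \<le> t \<Longrightarrow> (Y has_vector_derivative D t) (at t within {0..})"
    "continuous_on {0..} D"
    "\<And>t s. 0 \<le> t \<Longrightarrow> Y t s \<in> {a..b}"
    "\<And>t. 0 \<le> t \<Longrightarrow> (\<integral>x. g (Y t (u0 x)) \<partial>lebesgue_on \<Omega>) \<noteq> 0"
    "\<And>t s. 0 \<le> t \<Longrightarrow> D t s = g (Y t s) * p (Y t s) -
      g (Y t s) * ((\<integral>x. g (Y t (u0 x)) * p (Y t (u0 x)) \<partial>lebesgue_on \<Omega>) / (\<integral>x. g (Y t (u0 x)) \<partial>lebesgue_on \<Omega>))"
    by (rule exists_flow) blast
  define u where "u = (\<lambda>t x. apply_bcontfun (Y t) (u0 x))"
  have F: "F_op \<Omega> p g (u t) = (\<lambda>x. D t (u0 x))" if "0 \<le> t" for t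
    by (auto simp: F_op_def u_def Y(6)[OF that])
  have "is_global_solution \<Omega> p g u0 u"
    unfolding is_solution_def Let_def
  proof (intro conjI ballI)
    have I: "{t. 0 \<le> t \<and> ereal t < \<infinity>} = {0..}" by auto
    show "C1_Linf_on \<Omega> {t. 0 \<le> t \<and> ereal t < \<infinity>} u"
      unfolding C1_Linf_on_def I u_def
      using Y by (intro conjI exI[of _ "\<lambda>t x. D t (u0 x)"] ballI has_Linf_derivative_bcontfun_comp
          continuous_Linf_on_bcontfun_comp bcontfun_comp_in_Linf u0) auto
    fix t assume "t \<in> {t. 0 \<le> t \<and> ereal t < \<infinity>}"
    then have t: "0 \<le> t" by simp
    show "has_Linf_derivative \<Omega> {t. 0 \<le> t \<and> ereal t < \<infinity>} u (F_op \<Omega> p g (u t)) t"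
      unfolding I F[OF t] unfolding u_def
      by (intro has_Linf_derivative_bcontfun_comp u0 Y(2)[OF t])
    show "(LINT x|lebesgue_on \<Omega>. g (u t x)) \<noteq> 0"
      using Y(5)[OF t] by (simp add: u_def)
  next
    show "AE x in lebesgue_on \<Omega>. u 0 x = u0 x"
      using range by eventually_elim (auto simp: u_def Y(1))
  qed auto
  with that[of u] Y(4) show thesis by (simp add: u_def)
qed

section \<open>The invariant interval under each hypothesis\<close>

theorem theorem2p5:
  fixes \<Omega> :: "(real ^ 'n) set"
    and p g :: "real \<Rightarrow> real"
    and u0 :: "real ^ 'n \<Rightarrow> real"
  assumes "open \<Omega>" and "bounded \<Omega>"
    and "p C1_differentiable_on UNIV" and "strict_mono p"
    and "g C1_differentiable_on UNIV"
    and "g 0 = 0" and "g 1 = 0"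
    and "\<forall>s\<in>{0<..<1}. g s > 0"
    and "\<forall>s\<in>{..<0} \<union> {1<..}. g s < 0"
    and "H1 \<Omega> u0 \<or> H2 \<Omega> g u0 \<or> H3 \<Omega> u0"
  shows "\<exists>u. is_global_solution \<Omega> p g u0 u \<and>
    (H1 \<Omega> u0 \<longrightarrow> (\<forall>t\<ge>0. AE x in lebesgue_on \<Omega>.
       1 \<le> u t x \<and> ereal (u t x) \<le> esssup (lebesgue_on \<Omega>) (\<lambda>y. ereal (u0 y)))) \<and>
    (H2 \<Omega> g u0 \<longrightarrow> (\<forall>t\<ge>0. AE x in lebesgue_on \<Omega>. 0 \<le> u t x \<and> u t x \<le> 1)) \<and>
    (H3 \<Omega> u0 \<longrightarrow> (\<forall>t\<ge>0. AE x in lebesgue_on \<Omega>.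
       essinf (lebesgue_on \<Omega>) (\<lambda>y. ereal (u0 y)) \<le> ereal (u t x) \<and> u t x \<le> 0))"
proof -
  let ?M = "lebesgue_on \<Omega>"
  have \<Omega>: "\<Omega> \<in> lmeasurable" using assms by (simp add: lmeasurable_open)
  interpret finite_measure ?M by (rule finite_measure_lebesgue_on[OF \<Omega>])
  have g_cont: "continuous_on UNIV g"
    by (rule differentiable_imp_continuous_on[OF C1_diff_imp_diff[OF assms(5)]])
  have [measurable]: "g \<in> borel_measurable borel"
    using g_cont by (rule borel_measurable_continuous_onI)
  have g_neg: "g s < 0" if "s < 0 \<or> 1 < s" for s using assms(9) that by auto
  have g_zero: "s = 1" if "g s = 0" "1 \<le> s" for s
    using g_neg[of s] that by (cases "1 < s") auto
  have g_zero': "s = 0" if "g s = 0" "s \<le> 0" for s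
    using g_neg[of s] that by (cases "s < 0") auto
  have g_nonneg: "0 \<le> g s" if "s \<in> {0..1}" for s
    using assms(6,7,8) that by (cases "s = 0 \<or> s = 1") (auto simp: less_imp_le)
  have g_nonpos: "g s \<le> 0" if "s \<le> 0 \<or> 1 \<le> s" for s
    using g_neg[of s] assms(6,7) that by (cases "s = 0 \<or> s = 1") auto
  note exists_between = exists_global_solution_between[OF \<Omega> assms(3) strict_mono_mono[OF assms(4)] assms(5)]
  \<comment> \<open>H1 and H3 do not contain this condition. There \<open>g (u0 x)\<close> is
    nonpositive, so a zero integral would force it to vanish almost everywhere;
    \<open>[a, b]\<close> serves to make it bounded, hence integrable.\<close>
  have mass: "(LINT x|?M. g (u0 x)) \<noteq> 0"
    if u0: "u0 \<in> borel_measurable ?M" and ab: "AE x in ?M. u0 x \<in> {a..b}"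
      and out: "AE x in ?M. u0 x \<le> 0 \<or> 1 \<le> u0 x" and nz: "\<not> (AE x in ?M. g (u0 x) = 0)" for a b
  proof -
    note u0 [measurable]
    obtain B where B: "\<forall>s\<in>{a..b}. norm (g s) \<le> B"
      using compact_imp_bounded[OF compact_continuous_image[OF continuous_on_subset[OF g_cont], of "{a..b}"]]
      unfolding bounded_iff by auto
    have "AE x in ?M. norm (- g (u0 x)) \<le> B"
      using ab by eventually_elim (use B in auto)
    then have "integrable ?M (\<lambda>x. - g (u0 x))"
      by (rule integrable_const_bound) measurable
    moreover have "AE x in ?M. 0 \<le> - g (u0 x)"
      using out by eventually_elim (use g_nonpos in auto)
    ultimately show ?thesis
      using nz integral_nonneg_eq_0_iff_AE[of ?M "\<lambda>x. - g (u0 x)"] by simp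
  qed
  \<comment> \<open>As the hypotheses exclude one another, the solution built for one of them
    satisfies the other two implications vacuously.\<close>
  have excl: "\<not> (H1 \<Omega> u0 \<and> H2 \<Omega> g u0)" "\<not> (H1 \<Omega> u0 \<and> H3 \<Omega> u0)" "\<not> (H2 \<Omega> g u0 \<and> H3 \<Omega> u0)"
  proof -
    have "AE x in ?M. u0 x = 1" if "AE x in ?M. 1 \<le> u0 x" "AE x in ?M. u0 x \<le> 1"
      using that by eventually_elim auto
    moreover have "AE x in ?M. u0 x \<le> 1" if "AE x in ?M. u0 x \<le> 0"
      using that by eventually_elim auto
    moreover have "AE x in ?M. u0 x = 0" if "AE x in ?M. 0 \<le> u0 x" "AE x in ?M. u0 x \<le> 0"
      using that by eventually_elim auto
    ultimately show "\<not> (H1 \<Omega> u0 \<and> H2 \<Omega> g u0)" "\<not> (H1 \<Omega> u0 \<and> H3 \<Omega> u0)" "\<not> (H2 \<Omega> g u0 \<and> H3 \<Omega> u0)"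
      by (auto simp: H1_def H2_def H3_def)
  qed
  consider "H1 \<Omega> u0" | "H2 \<Omega> g u0" | "H3 \<Omega> u0" using assms by blast
  then show ?thesis
  proof cases
    case 1
    then have u0: "u0 \<in> Linf \<Omega>" and ge: "AE x in ?M. 1 \<le> u0 x" and ne: "\<not> (AE x in ?M. u0 x = 1)"
      by (auto simp: H1_def)
    have meas: "u0 \<in> borel_measurable ?M" using u0 by (simp add: Linf_def)
    obtain b where b: "esssup ?M (\<lambda>x. ereal (u0 x)) = ereal b" "1 \<le> b"
      and range: "AE x in ?M. u0 x \<in> {1..b}"
      using Linf_esssup_real[OF u0 ge ne] .
    \<comment> \<open>On the half line above \<open>1\<close>, \<open>g\<close> vanishes only at
      \<open>1\<close>.\<close>
    have "\<not> (AE x in ?M. g (u0 x) = 0)"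
    proof
      assume "AE x in ?M. g (u0 x) = 0"
      with ge have "AE x in ?M. u0 x = 1" by eventually_elim (rule g_zero)
      with ne show False by simp
    qed
    then have "(LINT x|?M. g (u0 x)) \<noteq> 0"
      by (intro mass[OF meas range]) (use ge in auto)
    then obtain u where "is_global_solution \<Omega> p g u0 u" "\<And>t x. 0 \<le> t \<Longrightarrow> u t x \<in> {1..b}"
      using exists_between[of 1 b "-1" u0] g_nonpos b(2) meas range by auto
    then show ?thesis using 1 excl b(1) by (intro exI[of _ u]) auto
  next
    case 2
    then have u0: "u0 \<in> borel_measurable ?M" and range: "AE x in ?M. u0 x \<in> {0..1}"
      and "(LINT x|?M. g (u0 x)) \<noteq> 0"
      by (auto simp: H2_def Linf_def)
    then obtain u where "is_global_solution \<Omega> p g u0 u" "\<And>t x. 0 \<le> t \<Longrightarrow> u t x \<in> {0..1}"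
      using exists_between[of 0 1 1 u0] g_nonneg assms(6,7) by auto
    then show ?thesis using 2 excl by (intro exI[of _ u]) auto
  next
    case 3
    then have u0: "u0 \<in> Linf \<Omega>" and le: "AE x in ?M. u0 x \<le> 0" and ne: "\<not> (AE x in ?M. u0 x = 0)"
      by (auto simp: H3_def)
    have meas: "u0 \<in> borel_measurable ?M" using u0 by (simp add: Linf_def)
    \<comment> \<open>\<open>essinf\<close> is defined by reflection, so the lower end
      \<open>- b\<close> comes from the essential supremum of \<open>- u0\<close>.\<close>
    have "(\<lambda>x. - u0 x) \<in> Linf \<Omega>" using u0 by (simp add: Linf_def Linf_norm_def)
    then obtain b where b: "esssup ?M (\<lambda>x. ereal (- u0 x)) = ereal b" "0 \<le> b"
      and range': "AE x in ?M. - u0 x \<in> {0..b}"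
      using Linf_esssup_real[of "\<lambda>x. - u0 x" \<Omega> 0] le ne by auto
    have range: "AE x in ?M. u0 x \<in> {- b..0}" using range' by eventually_elim auto
    have "\<not> (AE x in ?M. g (u0 x) = 0)"
    proof
      assume "AE x in ?M. g (u0 x) = 0"
      with le have "AE x in ?M. u0 x = 0" by eventually_elim (rule g_zero')
      with ne show False by simp
    qed
    then have "(LINT x|?M. g (u0 x)) \<noteq> 0"
      by (intro mass[OF meas range]) (use le in auto)
    then obtain u where "is_global_solution \<Omega> p g u0 u" "\<And>t x. 0 \<le> t \<Longrightarrow> u t x \<in> {- b..0}"
      using exists_between[of "- b" 0 "-1" u0] g_nonpos b(2) meas range by auto
    then show ?thesis using 3 excl b(1) by (intro exI[of _ u]) (auto simp: essinf_def)
  qed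
qed

end
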